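(* For each $n\ge 1$ let $X_{1,n},\dots,X_{n,n}$ be independent Bernoulli random variables with $P(X_{i,n}=1)=b(i;n)$, let $V_n=X_{1,n}+\cdots+X_{n,n}$, $\lambda_n=\sum_{i=1}^n b(i;n)$ and $m_n=\max_{1\le i\le n} b(i;n)$. Suppose that $\lim_{n\to+\infty}\lambda_n=\lambda$ with $0<\lambda\le+\infty$. If $\lim_{n\to+\infty} m_n=0$, then for any function $\phi(n)$ such that $\phi(n)\,m_n\to 0$ as $n\to+\infty$, $$\sup_{\{k:\,k^2\le\phi(n)\}}\left|\frac{P(V_n=k)}{P(V_n=0)\,\lambda_n^k/k!}-1\right|\longrightarrow 0\qquad (n\to+\infty).$$
   Context: The $X_{i,n}$ take values in $\{0,1\}$ and are not assumed identically distributed; they form a triangular array, so $b(i;n)\in[0,1]$ may depend on $n$. The function $\phi$ is a real-valued function of the positive integer $n$. In the supremum, $k$ ranges over non-negative integers (a supremum over the empty set is taken to be $0$). *)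

theory Defs
  imports "HOL-Probability.Probability"
begin

definition row_sum :: "(nat \<Rightarrow> nat \<Rightarrow> 'a \<Rightarrow> real) \<Rightarrow> nat \<Rightarrow> 'a \<Rightarrow> real" where
  "row_sum X n \<omega> = (\<Sum>i = 1..n. X i n \<omega>)"

definition row_mean :: "(nat \<Rightarrow> nat \<Rightarrow> real) \<Rightarrow> nat \<Rightarrow> real" where
  "row_mean b n = (\<Sum>i = 1..n. b i n)"

(* Unspecified at n = 0, where the maximum is over the empty set; only n \<ge> 1 matters. *)
definition row_max :: "(nat \<Rightarrow> nat \<Rightarrow> real) \<Rightarrow> nat \<Rightarrow> real" where
  "row_max b n = Max ((\<lambda>i. b i n) ` {1..n})"

(* The supremum is taken in [0, \<infinity>], where the supremum of the empty set is 0;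
   in type real, Sup {} is unspecified. *)
definition poisson_ratio_error ::
  "(nat \<Rightarrow> 'a measure) \<Rightarrow> (nat \<Rightarrow> nat \<Rightarrow> 'a \<Rightarrow> real) \<Rightarrow> (nat \<Rightarrow> nat \<Rightarrow> real) \<Rightarrow>
   (nat \<Rightarrow> real) \<Rightarrow> nat \<Rightarrow> ennreal" where
  "poisson_ratio_error M X b \<phi> n =
     (SUP k \<in> {k::nat. (real k)\<^sup>2 \<le> \<phi> n}.
        ennreal \<bar>\<P>(\<omega> in M n. row_sum X n \<omega> = real k) /
                (\<P>(\<omega> in M n. row_sum X n \<omega> = 0) * row_mean b n ^ k / fact k) - 1\<bar>)"

end

theory Submission imports Defs begin

text \<open>
  Conditioning on which variables equal 1 shows that, for a row with success probabilities
  \<open>p i < 1\<close>, the ratio \<open>P(V = k) / P(V = 0)\<close> is the elementary symmetric sum \<open>e\<^sub>k\<close> of the odds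
  \<open>p i / (1 - p i)\<close> (\<open>prob_sum_eq_odds\<close>).  So the theorem is a purely deterministic
  comparison of \<open>k! e\<^sub>k\<close> with \<open>\<lambda>\<^sup>k\<close>.

  With the probabilities in place of the odds, both would be sums of products over \<open>k\<close>-tuples of
  indices: \<open>\<lambda>\<^sup>k\<close> over all tuples, \<open>k! e\<^sub>k\<close> over those without repetition.  Dropping
  repetitions costs at most a relative error \<open>k\<^sup>2 m / \<lambda>\<close>, because a fresh
  index misses a set of \<open>j\<close> earlier ones whose total weight is at most \<open>j m\<close>
  (\<open>elem_sym_lower\<close>).  Replacing a probability by its odds costs at most a factor \<open>1 / (1 - m)\<close>
  for each of the \<open>k\<close> indices, hence \<open>1 / (1 - k m)\<close> by Bernoulli's inequality.  Since
  \<open>k \<le> k\<^sup>2 \<le> \<phi>\<close>, both errors are controlled by \<open>\<phi> m\<close>, uniformly in \<open>k\<close>, as soon as \<open>\<lambda>\<close> is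
  bounded away from 0, which positivity of its limit ensures whether that limit is finite or not.
\<close>

section \<open>Elementary symmetric sums\<close>

definition elem_sym :: "'i set \<Rightarrow> ('i \<Rightarrow> real) \<Rightarrow> nat \<Rightarrow> real" where
  "elem_sym I f k = (\<Sum>S | S \<subseteq> I \<and> card S = k. \<Prod>i\<in>S. f i)"

lemma elem_sym_0 [simp]:
  assumes "finite I"
  shows "elem_sym I f 0 = 1"
proof -
  have "{S. S \<subseteq> I \<and> card S = 0} = {{}}"
    using assms by (auto dest: finite_subset)
  then show ?thesis by (simp add: elem_sym_def)
qed

lemma elem_sym_nonneg:
  assumes "\<And>i. i \<in> I \<Longrightarrow> 0 \<le> f i"
  shows "0 \<le> elem_sym I f k"
  unfolding elem_sym_def using assms by (intro sum_nonneg prod_nonneg) auto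

lemma elem_sym_mono:
  assumes "\<And>i. i \<in> I \<Longrightarrow> 0 \<le> f i" "\<And>i. i \<in> I \<Longrightarrow> f i \<le> g i"
  shows "elem_sym I f k \<le> elem_sym I g k"
  unfolding elem_sym_def using assms by (intro sum_mono prod_mono) blast

text \<open>
  Double counting of the pairs of a \<open>(k + 1)\<close>-set and a marked element of it: removing the mark
  leaves a \<open>k\<close>-set together with an index outside it.
\<close>

lemma elem_sym_Suc:
  assumes "finite I"
  shows "real (Suc k) * elem_sym I f (Suc k) =
    (\<Sum>S | S \<subseteq> I \<and> card S = k. (\<Prod>i\<in>S. f i) * (\<Sum>i\<in>I - S. f i))"
proof -
  let ?A = "\<lambda>k. {S. S \<subseteq> I \<and> card S = k}"
  have fin: "finite (?A j)" for j using assms by simp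
  have finS: "finite S" if "S \<in> ?A j" for S j
    using that assms by (auto dest: finite_subset)
  have "real (Suc k) * elem_sym I f (Suc k) = (\<Sum>T\<in>?A (Suc k). \<Sum>x\<in>T. \<Prod>i\<in>T. f i)"
    unfolding elem_sym_def sum_distrib_left by (intro sum.cong refl) (simp del: of_nat_Suc)
  also have "\<dots> = (\<Sum>(T, x)\<in>Sigma (?A (Suc k)) (\<lambda>T. T). \<Prod>i\<in>T. f i)"
    using fin finS by (intro sum.Sigma) blast+
  also have "\<dots> = (\<Sum>(S, x)\<in>Sigma (?A k) (\<lambda>S. I - S). (\<Prod>i\<in>S. f i) * f x)"
  proof (rule sum.reindex_bij_witness
      [where i = "\<lambda>(S, x). (insert x S, x)" and j = "\<lambda>(T, x). (T - {x}, x)"], goal_cases)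
    case (2 a)
    then obtain T x where a: "a = (T, x)" "T \<subseteq> I" "card T = Suc k" "x \<in> T" by auto
    then show ?case by auto
  next
    case (4 b)
    then obtain S x where b: "b = (S, x)" "S \<subseteq> I" "card S = k" "x \<in> I" "x \<notin> S" by auto
    then have "finite S" using assms by (auto dest: finite_subset)
    then show ?case using b by auto
  next
    case (5 a)
    then obtain T x where a: "a = (T, x)" "T \<subseteq> I" "card T = Suc k" "x \<in> T" by auto
    then have "finite T" using assms by (auto dest: finite_subset)
    then show ?case using a by (simp add: prod.remove[of T x] mult.commute)
  qed auto
  also have "\<dots> = (\<Sum>S\<in>?A k. \<Sum>x\<in>I - S. (\<Prod>i\<in>S. f i) * f x)"
    using fin assms by (intro sum.Sigma[symmetric]) blast+
  finally show ?thesis by (simp add: sum_distrib_left)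
qed

lemma elem_sym_upper:
  assumes "finite I" and nonneg: "\<And>i. i \<in> I \<Longrightarrow> 0 \<le> f i"
  shows "fact k * elem_sym I f k \<le> (\<Sum>i\<in>I. f i) ^ k"
proof (induction k)
  case (Suc k)
  have "real (Suc k) * elem_sym I f (Suc k) \<le> elem_sym I f k * (\<Sum>i\<in>I. f i)"
    unfolding elem_sym_Suc[OF \<open>finite I\<close>] unfolding elem_sym_def sum_distrib_right
    using assms by (intro sum_mono mult_left_mono sum_mono2 prod_nonneg) auto
  then have "fact k * (real (Suc k) * elem_sym I f (Suc k))
      \<le> fact k * (elem_sym I f k * (\<Sum>i\<in>I. f i))"
    by (intro mult_left_mono) auto
  also have "\<dots> \<le> (\<Sum>i\<in>I. f i) ^ k * (\<Sum>i\<in>I. f i)"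
    unfolding mult.assoc[symmetric]
    using Suc nonneg by (intro mult_right_mono sum_nonneg) auto
  finally show ?case by (simp add: mult_ac del: of_nat_Suc)
qed (simp add: \<open>finite I\<close>)

text \<open>
  A \<open>k\<close>-set carries weight at most \<open>k m\<close>, so with \<open>\<lambda>\<close> the total weight the normalised sum
  \<open>a k = k! e\<^sub>k / \<lambda>\<^sup>k\<close> satisfies \<open>a (k + 1) \<ge> a k (1 - k m / \<lambda>)\<close>.  As \<open>a k \<le> 1\<close>, each step loses
  at most \<open>k m / \<lambda>\<close> additively, and the losses add up to at most \<open>k\<^sup>2 m / \<lambda>\<close>.
\<close>

lemma elem_sym_lower:
  assumes "finite I" and nonneg: "\<And>i. i \<in> I \<Longrightarrow> 0 \<le> f i"
    and le: "\<And>i. i \<in> I \<Longrightarrow> f i \<le> m" and "0 \<le> m" and pos: "0 < (\<Sum>i\<in>I. f i)"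
  shows "1 - (real k)\<^sup>2 * m / (\<Sum>i\<in>I. f i) \<le> fact k * elem_sym I f k / (\<Sum>i\<in>I. f i) ^ k"
proof (induction k)
  case (Suc k)
  define L where "L = (\<Sum>i\<in>I. f i)"
  define a where "a = (\<lambda>k. fact k * elem_sym I f k / L ^ k)"
  have L: "0 < L" using pos by (simp add: L_def)
  have a1: "a k \<le> 1"
    using elem_sym_upper[OF \<open>finite I\<close> nonneg, where k = k] L by (simp add: a_def L_def field_simps)
  have "elem_sym I f k * (L - real k * m) \<le> real (Suc k) * elem_sym I f (Suc k)"
    unfolding elem_sym_Suc[OF \<open>finite I\<close>] unfolding elem_sym_def sum_distrib_right
  proof (intro sum_mono mult_left_mono prod_nonneg)
    fix S assume S: "S \<in> {S. S \<subseteq> I \<and> card S = k}"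
    have "(\<Sum>i\<in>S. f i) \<le> real k * m"
      using sum_bounded_above[of S f m] S le by auto
    moreover have "(\<Sum>i\<in>I - S. f i) = L - (\<Sum>i\<in>S. f i)"
      unfolding L_def using S \<open>finite I\<close> by (intro sum_diff) auto
    ultimately show "L - real k * m \<le> (\<Sum>i\<in>I - S. f i)" by simp
  qed (use nonneg in auto)
  then have "fact k * (elem_sym I f k * (L - real k * m)) / L ^ Suc k
      \<le> fact k * (real (Suc k) * elem_sym I f (Suc k)) / L ^ Suc k"
    using L by (intro divide_right_mono mult_left_mono) auto
  also have "\<dots> = a (Suc k)" by (simp add: a_def mult_ac del: of_nat_Suc)
  also have "fact k * (elem_sym I f k * (L - real k * m)) / L ^ Suc k = a k * (1 - real k * m / L)"
    using L by (simp add: a_def field_simps)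
  finally have step: "a k - a k * (real k * m / L) \<le> a (Suc k)" by (simp add: algebra_simps)
  have "a k * (real k * m / L) \<le> 1 * (real k * m / L)"
    using a1 L \<open>0 \<le> m\<close> by (intro mult_right_mono) auto
  moreover have "(real k)\<^sup>2 * m / L + real k * m / L \<le> (real (Suc k))\<^sup>2 * m / L"
  proof -
    have "((real k)\<^sup>2 + real k) * m / L \<le> (real (Suc k))\<^sup>2 * m / L"
      using L \<open>0 \<le> m\<close> by (intro divide_right_mono mult_right_mono)
          (auto simp: power2_eq_square algebra_simps)
    then show ?thesis by (simp add: algebra_simps add_divide_distrib)
  qed
  moreover have "1 - (real k)\<^sup>2 * m / L \<le> a k"
    using Suc by (simp add: a_def L_def)
  ultimately have "1 - (real (Suc k))\<^sup>2 * m / L \<le> a (Suc k)" using step by linarith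
  then show ?case by (simp only: a_def L_def)
qed (simp add: \<open>finite I\<close>)

text \<open>
  The upper estimate is applied to the odds and the lower one to the probabilities themselves,
  which the odds dominate.
\<close>

lemma elem_sym_odds_bound:
  assumes "finite I" and nonneg: "\<And>i. i \<in> I \<Longrightarrow> 0 \<le> p i"
    and le: "\<And>i. i \<in> I \<Longrightarrow> p i \<le> m" and m: "0 \<le> m" "m < 1"
    and c: "0 < c" "c \<le> (\<Sum>i\<in>I. p i)" and d: "(real k)\<^sup>2 * m \<le> d" "d \<le> 1 / 2"
  shows "\<bar>fact k * elem_sym I (\<lambda>i. p i / (1 - p i)) k / (\<Sum>i\<in>I. p i) ^ k - 1\<bar> \<le> d / c + 2 * d"
proof -
  define L where "L = (\<Sum>i\<in>I. p i)"
  let ?r = "\<lambda>i. p i / (1 - p i)"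
  have L: "0 < L" "c \<le> L" using c by (auto simp: L_def)
  have d0: "0 \<le> d" using d m by (meson mult_nonneg_nonneg order_trans zero_le_power2)
  have p1: "p i < 1" if "i \<in> I" for i using le[OF that] m by simp
  have r0: "0 \<le> ?r i" if "i \<in> I" for i using nonneg[OF that] p1[OF that] by simp
  have pr: "p i \<le> ?r i" if "i \<in> I" for i
    using nonneg[OF that] p1[OF that] by (simp add: le_divide_eq mult_left_le)
  have "1 - d / c \<le> 1 - (real k)\<^sup>2 * m / L"
    using d c L m d0 by (intro diff_left_mono frac_le) auto
  also have "\<dots> \<le> fact k * elem_sym I p k / L ^ k"
    unfolding L_def using assms by (intro elem_sym_lower) auto
  also have "\<dots> \<le> fact k * elem_sym I ?r k / L ^ k"
    using L nonneg pr by (intro divide_right_mono mult_left_mono elem_sym_mono) auto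
  finally have lower: "1 - d / c \<le> fact k * elem_sym I ?r k / L ^ k" .
  have "(\<Sum>i\<in>I. ?r i) \<le> L / (1 - m)"
    unfolding L_def sum_divide_distrib
    using nonneg le m by (intro sum_mono frac_le) auto
  \<comment> \<open>each of the \<open>k\<close> factors contributes at most \<open>1 / (1 - m)\<close>\<close>
  then have "(\<Sum>i\<in>I. ?r i) ^ k \<le> (L / (1 - m)) ^ k"
    using r0 by (intro power_mono sum_nonneg) auto
  moreover have "fact k * elem_sym I ?r k \<le> (\<Sum>i\<in>I. ?r i) ^ k"
    using \<open>finite I\<close> r0 by (rule elem_sym_upper)
  ultimately have "fact k * elem_sym I ?r k / L ^ k \<le> (L / (1 - m)) ^ k / L ^ k"
    using L by (intro divide_right_mono) auto
  also have "\<dots> = 1 / (1 - m) ^ k" using L by (simp add: power_divide)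
  also have "\<dots> \<le> 1 / (1 - d)"
  proof (intro frac_le)
    have "real k \<le> (real k)\<^sup>2"
      by (cases k) (auto simp: power2_eq_square)
    then have "real k * m \<le> d" using d m by (meson mult_right_mono order_trans)
    then show "1 - d \<le> (1 - m) ^ k"
      using Bernoulli_inequality[of "- m" k] m by simp
  qed (use d in auto)
  also have "\<dots> \<le> 1 + 2 * d"
  proof -
    have "d * (2 * d) \<le> d * 1" using d d0 by (intro mult_left_mono) auto
    then have "1 \<le> (1 + 2 * d) * (1 - d)" by (simp add: algebra_simps)
    then show ?thesis using d by (simp add: divide_le_eq)
  qed
  finally have "fact k * elem_sym I ?r k / L ^ k \<le> 1 + 2 * d" .
  moreover have "0 \<le> d / c" using d0 c by simp
  ultimately show ?thesis
    unfolding L_def[symmetric] abs_le_iff using lower d0 by linarith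
qed

section \<open>The distribution of a sum of independent Bernoulli variables\<close>

text \<open>
  Up to a null set the event that the sum equals \<open>k\<close> is the disjoint union, over the \<open>k\<close>-sets \<open>S\<close>,
  of the events that exactly the variables with index in \<open>S\<close> equal 1.
\<close>

lemma (in prob_space) prob_sum_eq_sum_prod:
  fixes X :: "'i \<Rightarrow> 'a \<Rightarrow> real"
  assumes I: "finite I" "I \<noteq> {}"
    and indep: "indep_vars (\<lambda>_. borel) X I"
    and zero_one: "\<And>i. i \<in> I \<Longrightarrow> AE \<omega> in M. X i \<omega> \<in> {0, 1}"
    and p: "\<And>i. i \<in> I \<Longrightarrow> \<P>(\<omega> in M. X i \<omega> = 1) = p i"
  shows "\<P>(\<omega> in M. (\<Sum>i\<in>I. X i \<omega>) = real k) =
    (\<Sum>S | S \<subseteq> I \<and> card S = k. (\<Prod>i\<in>S. p i) * (\<Prod>i\<in>I - S. 1 - p i))"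
proof -
  let ?A = "{S. S \<subseteq> I \<and> card S = k}"
  define E where "E = (\<lambda>S. \<Inter>i\<in>I. X i -` {indicator S i} \<inter> space M)"
  have rv [measurable]: "X i \<in> borel_measurable M" if "i \<in> I" for i
    using indep that by (auto simp: indep_vars_def)
  have E_iff: "\<omega> \<in> E S \<longleftrightarrow> \<omega> \<in> space M \<and> (\<forall>i\<in>I. X i \<omega> = indicator S i)" for S \<omega>
    using I by (auto simp: E_def)
  have E_sets: "E S \<in> events" for S
    unfolding E_def using I rv by (intro sets.finite_INT measurable_sets[OF rv]) auto
  have one: "prob (X i -` {1} \<inter> space M) = p i" if "i \<in> I" for i
    using p[OF that] by (simp add: vimage_def Int_def conj_commute)
  have zero: "prob (X i -` {0} \<inter> space M) = 1 - p i" if "i \<in> I" for i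
  proof -
    have ev: "X i -` {1} \<inter> space M \<in> events" "X i -` {0} \<inter> space M \<in> events"
      using measurable_sets[OF rv[OF that]] by auto
    have "prob (X i -` {0} \<inter> space M) = prob (space M - (X i -` {1} \<inter> space M))"
      using zero_one[OF that] ev by (intro finite_measure_eq_AE) auto
    then show ?thesis using prob_compl[OF ev(1)] one[OF that] by simp
  qed
  have prob_E: "prob (E S) = (\<Prod>i\<in>S. p i) * (\<Prod>i\<in>I - S. 1 - p i)" if "S \<subseteq> I" for S
  proof -
    have "prob (E S) = (\<Prod>i\<in>I. prob (X i -` {indicator S i} \<inter> space M))"
      unfolding E_def using I by (intro indep_varsD[OF indep]) auto
    also have "\<dots> = (\<Prod>i\<in>I. if i \<in> S then p i else 1 - p i)"
      using one zero by (intro prod.cong) auto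
    also have "\<dots> = (\<Prod>i\<in>S. p i) * (\<Prod>i\<in>I - S. 1 - p i)"
      using that I by (simp add: prod.If_cases Int_absorb1 Diff_eq)
    finally show ?thesis .
  qed
  have "\<P>(\<omega> in M. (\<Sum>i\<in>I. X i \<omega>) = real k) = prob (\<Union>S\<in>?A. E S)"
  proof (rule finite_measure_eq_AE)
    have "AE \<omega> in M. \<forall>i\<in>I. X i \<omega> \<in> {0, 1}"
      using I zero_one by (intro AE_finite_allI) auto
    then show "AE \<omega> in M. \<omega> \<in> {\<omega> \<in> space M. (\<Sum>i\<in>I. X i \<omega>) = real k} \<longleftrightarrow> \<omega> \<in> (\<Union>S\<in>?A. E S)"
    proof (eventually_elim, safe)
      fix \<omega> assume X: "\<forall>i\<in>I. X i \<omega> \<in> {0, 1}" and \<omega>: "\<omega> \<in> space M"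
        and eq: "(\<Sum>i\<in>I. X i \<omega>) = real k"
      define S where "S = {i \<in> I. X i \<omega> = 1}"
      have "(\<Sum>i\<in>I. X i \<omega>) = (\<Sum>i\<in>I. if i \<in> S then 1 else 0)"
        using X by (intro sum.cong) (auto simp: S_def)
      also have "\<dots> = real (card S)"
        using I by (simp add: sum.If_cases S_def Collect_conj_eq)
      finally have "card S = k" using eq by simp
      moreover have "\<omega> \<in> E S" using X \<omega> by (auto simp: E_iff S_def indicator_def)
      moreover have "S \<subseteq> I" by (auto simp: S_def)
      ultimately show "\<omega> \<in> (\<Union>S\<in>?A. E S)" by blast
    next
      fix \<omega> S assume S: "S \<subseteq> I" "k = card S" and E: "\<omega> \<in> E S"
      show "\<omega> \<in> space M" using E by (simp add: E_iff)
      have "(\<Sum>i\<in>I. X i \<omega>) = (\<Sum>i\<in>I. indicator S i)"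
        using E by (intro sum.cong) (auto simp: E_iff)
      also have "\<dots> = real (card S)"
        using S I by (simp add: indicator_def sum.If_cases Int_absorb1)
      finally show "(\<Sum>i\<in>I. X i \<omega>) = real (card S)" .
    qed
    show "{\<omega> \<in> space M. (\<Sum>i\<in>I. X i \<omega>) = real k} \<in> events" by measurable
    show "(\<Union>S\<in>?A. E S) \<in> events" using I E_sets by (intro sets.finite_UN) auto
  qed
  also have "\<dots> = (\<Sum>S\<in>?A. prob (E S))"
  proof (rule finite_measure_finite_Union)
    show "disjoint_family_on E ?A"
      unfolding disjoint_family_on_def
    proof (intro ballI impI)
      fix S T assume ST: "S \<in> ?A" "T \<in> ?A" "S \<noteq> T"
      have "S = T" if "\<omega> \<in> E S" "\<omega> \<in> E T" for \<omega>
      proof -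
        have "(indicator S i :: real) = indicator T i" if "i \<in> I" for i
          using \<open>\<omega> \<in> E S\<close> \<open>\<omega> \<in> E T\<close> that by (simp add: E_iff)
        then have "i \<in> S \<longleftrightarrow> i \<in> T" if "i \<in> I" for i
          using that by (metis indicator_simps zero_neq_one)
        then show ?thesis using ST by auto
      qed
      then show "E S \<inter> E T = {}" using ST by blast
    qed
  qed (use I E_sets in auto)
  also have "\<dots> = (\<Sum>S\<in>?A. (\<Prod>i\<in>S. p i) * (\<Prod>i\<in>I - S. 1 - p i))"
    by (intro sum.cong) (auto simp: prob_E)
  finally show ?thesis .
qed

text \<open>
  The factor \<open>\<Prod>i\<in>I. 1 - p i\<close> is the probability that the sum vanishes; dividing by it cancels
  every failure probability outside \<open>S\<close> and turns those inside into the denominators of the odds.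
\<close>

lemma (in prob_space) prob_sum_eq_odds:
  fixes X :: "'i \<Rightarrow> 'a \<Rightarrow> real"
  assumes I: "finite I" "I \<noteq> {}"
    and indep: "indep_vars (\<lambda>_. borel) X I"
    and zero_one: "\<And>i. i \<in> I \<Longrightarrow> AE \<omega> in M. X i \<omega> \<in> {0, 1}"
    and p: "\<And>i. i \<in> I \<Longrightarrow> \<P>(\<omega> in M. X i \<omega> = 1) = p i"
    and p1: "\<And>i. i \<in> I \<Longrightarrow> p i < 1"
  shows "\<P>(\<omega> in M. (\<Sum>i\<in>I. X i \<omega>) = real k) =
    (\<Prod>i\<in>I. 1 - p i) * elem_sym I (\<lambda>i. p i / (1 - p i)) k"
proof -
  have "(\<Prod>i\<in>S. p i) * (\<Prod>i\<in>I - S. 1 - p i) =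
      (\<Prod>i\<in>I. 1 - p i) * (\<Prod>i\<in>S. p i / (1 - p i))" if "S \<subseteq> I" for S
  proof -
    have "(\<Prod>i\<in>S. 1 - p i) \<noteq> 0"
      using p1 that finite_subset[OF that I(1)] by force
    then show ?thesis
      using prod.subset_diff[OF that I(1), of "\<lambda>i. 1 - p i"]
      by (simp add: prod_dividef)
  qed
  then have "(\<Sum>S | S \<subseteq> I \<and> card S = k. (\<Prod>i\<in>S. p i) * (\<Prod>i\<in>I - S. 1 - p i)) =
      (\<Prod>i\<in>I. 1 - p i) * elem_sym I (\<lambda>i. p i / (1 - p i)) k"
    unfolding elem_sym_def sum_distrib_left by (intro sum.cong) auto
  with prob_sum_eq_sum_prod[OF I indep zero_one p] show ?thesis by simp
qed

section \<open>The Poisson approximation\<close>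

text \<open>
  The lower bound \<open>c\<close> stands in for \<open>\<lambda>\<^sub>n\<close>, which may tend to infinity: with \<open>c\<close> chosen once
  for all large \<open>n\<close>, the right-hand side depends on \<open>n\<close> only through \<open>\<phi> n * row_max b n\<close>.
\<close>

lemma poisson_ratio_error_le:
  fixes X :: "nat \<Rightarrow> nat \<Rightarrow> 'a \<Rightarrow> real"
  assumes n: "1 \<le> n" and M: "prob_space (M n)"
    and indep: "prob_space.indep_vars (M n) (\<lambda>_. borel) (\<lambda>i. X i n) {1..n}"
    and zero_one: "\<And>i. i \<in> {1..n} \<Longrightarrow> AE \<omega> in M n. X i n \<omega> \<in> {0, 1}"
    and b: "\<And>i. i \<in> {1..n} \<Longrightarrow> \<P>(\<omega> in M n. X i n \<omega> = 1) = b i n"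
    and c: "0 < c" "c \<le> row_mean b n"
    and small: "row_max b n < 1" and \<phi>: "\<phi> n * row_max b n \<le> 1 / 2"
  shows "poisson_ratio_error M X b \<phi> n
    \<le> ennreal (\<phi> n * row_max b n / c + 2 * (\<phi> n * row_max b n))"
  unfolding poisson_ratio_error_def
proof (intro SUP_least ennreal_leI)
  interpret prob_space "M n" by (rule M)
  fix k :: nat assume k: "k \<in> {k. (real k)\<^sup>2 \<le> \<phi> n}"
  have b0: "0 \<le> b i n" if "i \<in> {1..n}" for i
    using b[OF that] measure_nonneg by metis
  have bm: "b i n \<le> row_max b n" if "i \<in> {1..n}" for i
    unfolding row_max_def using that by (intro Max_ge) auto
  have m0: "0 \<le> row_max b n" using b0[of 1] bm[of 1] n by auto
  define P0 where "P0 = (\<Prod>i=1..n. 1 - b i n)"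
  define e where "e = elem_sym {1..n} (\<lambda>i. b i n / (1 - b i n))"
  have P0: "0 < P0" unfolding P0_def using bm small by (intro prod_pos) force
  have law: "\<P>(\<omega> in M n. row_sum X n \<omega> = real k) = P0 * e k" for k
    unfolding row_sum_def P0_def e_def
    using n indep zero_one b by (intro prob_sum_eq_odds) (use bm small in force)+
  from law[of 0] have "\<P>(\<omega> in M n. row_sum X n \<omega> = 0) = P0" by (simp add: e_def)
  then have "\<P>(\<omega> in M n. row_sum X n \<omega> = real k) /
      (\<P>(\<omega> in M n. row_sum X n \<omega> = 0) * row_mean b n ^ k / fact k)
      = fact k * e k / row_mean b n ^ k"
    using law[of k] P0 by simp
  moreover have "\<bar>fact k * e k / row_mean b n ^ k - 1\<bar>
      \<le> \<phi> n * row_max b n / c + 2 * (\<phi> n * row_max b n)"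
    unfolding e_def row_mean_def
  proof (rule elem_sym_odds_bound)
    show "(real k)\<^sup>2 * row_max b n \<le> \<phi> n * row_max b n"
      using k m0 by (intro mult_right_mono) auto
  qed (use b0 bm m0 small c \<phi> in \<open>auto simp: row_mean_def\<close>)
  ultimately show "\<bar>\<P>(\<omega> in M n. row_sum X n \<omega> = real k) /
      (\<P>(\<omega> in M n. row_sum X n \<omega> = 0) * row_mean b n ^ k / fact k) - 1\<bar>
      \<le> \<phi> n * row_max b n / c + 2 * (\<phi> n * row_max b n)"
    by simp
qed

theorem theorem1:
  fixes M :: "nat \<Rightarrow> 'a measure"
    and X :: "nat \<Rightarrow> nat \<Rightarrow> 'a \<Rightarrow> real"
    and b :: "nat \<Rightarrow> nat \<Rightarrow> real"
    and \<phi> :: "nat \<Rightarrow> real"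
    and \<Lambda> :: ereal
  assumes "\<And>n. n \<ge> 1 \<Longrightarrow> prob_space (M n)"
    and "\<And>n. n \<ge> 1 \<Longrightarrow> prob_space.indep_vars (M n) (\<lambda>_. borel) (\<lambda>i. X i n) {1..n}"
    and "\<And>n i. i \<in> {1..n} \<Longrightarrow> AE \<omega> in M n. X i n \<omega> \<in> {0, 1}"
    and "\<And>n i. i \<in> {1..n} \<Longrightarrow> \<P>(\<omega> in M n. X i n \<omega> = 1) = b i n"
    and "(\<lambda>n. ereal (row_mean b n)) \<longlonglongrightarrow> \<Lambda>"
    and "0 < \<Lambda>"
    and "row_max b \<longlonglongrightarrow> 0"
    and "(\<lambda>n. \<phi> n * row_max b n) \<longlonglongrightarrow> 0"
  shows "poisson_ratio_error M X b \<phi> \<longlonglongrightarrow> 0"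
proof -
  obtain c where c: "0 < c" "ereal c < \<Lambda>"
    using ereal_dense2[OF \<open>0 < \<Lambda>\<close>] by auto
  let ?g = "\<lambda>n. \<phi> n * row_max b n / c + 2 * (\<phi> n * row_max b n)"
  have "?g \<longlonglongrightarrow> 0 / c + 2 * 0"
    using c assms(8) by (intro tendsto_intros) auto
  then have g: "(\<lambda>n. ennreal (?g n)) \<longlonglongrightarrow> 0"
    using tendsto_ennrealI by fastforce
  have "\<forall>\<^sub>F n in sequentially. ereal c < ereal (row_mean b n)"
    using order_tendstoD(1)[OF assms(5) c(2)] .
  moreover have "\<forall>\<^sub>F n in sequentially. row_max b n < 1"
    using order_tendstoD(2)[OF assms(7)] by simp
  moreover have "\<forall>\<^sub>F n in sequentially. \<phi> n * row_max b n < 1 / 2"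
    using order_tendstoD(2)[OF assms(8), of "1 / 2"] by simp
  ultimately have "\<forall>\<^sub>F n in sequentially. poisson_ratio_error M X b \<phi> n \<le> ennreal (?g n)"
    using eventually_ge_at_top[of 1]
  proof eventually_elim
    case (elim n)
    then show ?case
      using assms(1-4) c by (intro poisson_ratio_error_le) auto
  qed
  then show ?thesis
    by (intro tendsto_sandwich[OF _ _ tendsto_const g]) auto
qed

end
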